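(* Let $G$ be a connected graph with $c(G)\ge 1$ and $\frac{g(G)}{c(G)}>\frac{7}{6}$. Then for every pair of nonadjacent vertices $v_i,v_j$ of $G$, with $e=v_iv_j$, it is impossible that the multiset of Laplacian matching roots of $G+e$ is obtained from that of $G$ by increasing exactly two entries (in distinct positions) by $1$ each and leaving all other entries unchanged; i.e., LMRIV does not occur to $G$ in two places by adding a new edge.
   Context: All graphs are finite, simple and undirected. For a connected graph $G$ with $n$ vertices and $m$ edges, $c(G)=m-n+1$ and $g(G)$ is the girth (length of a shortest cycle). $d(v)$ is the degree of $v$ in $G$, and $\mathcal{M}(G)$ is the set of matchings (including the empty one); $V(M)$ is the set of endpoints of edges of a matching $M$. The Laplacian matching polynomial is $\mathscr{LM}(G,x)=\sum_{M\in\mathcal{M}(G)}(-1)^{|M|}\prod_{v\in V(G)\setminus V(M)}(x-d(v))$; its roots (real and nonnegative) are the Laplacian matching roots, counted with multiplicity. $G+e$ is $G$ with the new edge $e$ added. *)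

theory Defs
  imports Complex_Main "HOL-Library.Multiset" "HOL-Computational_Algebra.Polynomial"
begin

text \<open>A graph is given by its vertex set \<open>V\<close> and its set \<open>E\<close> of two-element edges.\<close>

definition simple_graph :: "'a set \<Rightarrow> 'a set set \<Rightarrow> bool" where
  "simple_graph V E \<longleftrightarrow> finite V \<and> (\<forall>e\<in>E. e \<subseteq> V \<and> card e = 2)"

definition connected_graph :: "'a set \<Rightarrow> 'a set set \<Rightarrow> bool" where
  "connected_graph V E \<longleftrightarrow>
     V \<noteq> {} \<and> (\<forall>u\<in>V. \<forall>v\<in>V. (\<lambda>x y. {x, y} \<in> E)\<^sup>*\<^sup>* u v)"

definition degree_of :: "'a set set \<Rightarrow> 'a \<Rightarrow> nat" where
  "degree_of E v = card {e \<in> E. v \<in> e}"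

definition cyclomatic :: "'a set \<Rightarrow> 'a set set \<Rightarrow> int" where
  "cyclomatic V E = int (card E) - int (card V) + 1"

definition is_cycle :: "'a set set \<Rightarrow> 'a list \<Rightarrow> bool" where
  "is_cycle E vs \<longleftrightarrow>
     length vs \<ge> 3 \<and> distinct vs \<and> successively (\<lambda>x y. {x, y} \<in> E) vs \<and> {last vs, hd vs} \<in> E"

text \<open>For an acyclic graph this is the junk value \<open>0\<close>; a connected graph with
  \<open>cyclomatic V E \<ge> 1\<close> always has a cycle.\<close>

definition girth :: "'a set set \<Rightarrow> nat" where
  "girth E = Inf {length vs | vs. is_cycle E vs}"

definition matching :: "'a set set \<Rightarrow> 'a set set \<Rightarrow> bool" where
  "matching E M \<longleftrightarrow> M \<subseteq> E \<and> pairwise disjnt M"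

definition laplacian_matching_poly :: "'a set \<Rightarrow> 'a set set \<Rightarrow> 'b :: comm_ring_1 poly" where
  "laplacian_matching_poly V E =
     (\<Sum>M | matching E M. (-1) ^ card M * (\<Prod>v\<in>V - \<Union>M. [:- of_nat (degree_of E v), 1:]))"

text \<open>The roots are taken over the complex numbers, so that the multiset has exactly \<open>card V\<close>
  entries without appeal to the theorem that all of them are real.\<close>

definition laplacian_matching_roots :: "'a set \<Rightarrow> 'a set set \<Rightarrow> complex multiset" where
  "laplacian_matching_roots V E = proots (laplacian_matching_poly V E)"

text \<open>Laplacian matching root integral variation in two places, by adding the edge \<open>e\<close>.
  \<open>A\<close> collects the unchanged entries.\<close>

definition LMRIV_two_places :: "'a set \<Rightarrow> 'a set set \<Rightarrow> 'a set \<Rightarrow> bool" where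
  "LMRIV_two_places V E e \<longleftrightarrow>
     (\<exists>A a b. laplacian_matching_roots V E = A + {#a, b#} \<and>
              laplacian_matching_roots V (insert e E) = A + {#a + 1, b + 1#})"

end

theory Submission
  imports Defs
    "HOL-Computational_Algebra.Formal_Power_Series"
    "HOL-Computational_Algebra.Fundamental_Theorem_Algebra"
begin

text \<open>
  Let \<open>p\<close> and \<open>q\<close> be the degrees of the ends \<open>u\<close> and \<open>v\<close> of the new edge, and write \<open>LM\<^sub>u\<close>
  for the weighted matching polynomial of \<open>G - u\<close> in which every vertex keeps its degree in \<open>G\<close>.
  Then \<open>LM(G + e) = LM(G) - LM\<^sub>u - LM\<^sub>v\<close>, so if the roots \<open>a\<close> and \<open>b\<close> move to \<open>a + 1\<close> and \<open>b + 1\<close>,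
  then \<open>(LM\<^sub>u + LM\<^sub>v) / LM(G) = (2 x - a - b - 1) / ((x - a) (x - b))\<close>.
  The expansion of \<open>LM\<^sub>u / LM(G)\<close> in powers of \<open>1 / x\<close> is a continued fraction; its first
  coefficients depend only on \<open>p\<close> and on the degrees \<open>d(w)\<close> of the neighbours \<open>w\<close> of \<open>u\<close>. The first
  two comparisons of coefficients give \<open>a + b = p + q + 1\<close> and \<open>a b = p q\<close>; the next two
  combine to
  \<open>(\<Sum>w\<sim>u. (d(w) - 1 - q)\<^sup>2) + (\<Sum>w\<sim>v. (d(w) - 1 - p)\<^sup>2) = - 2 p q\<close>,
  which is absurd because \<open>p, q > 0\<close>.
\<close>

unbundle fps_syntax

section \<open>Matching polynomials with fixed vertex weights\<close>

text \<open>The weights are independent of the graph, so deleting a vertex shrinks \<open>S\<close>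
  but leaves \<open>E\<close> and the remaining weights alone. With degrees recomputed after each
  deletion the vertex recurrence would fail.\<close>

definition weighted_matching_poly ::
    "'a set set \<Rightarrow> ('a \<Rightarrow> 'b :: comm_ring_1) \<Rightarrow> 'a set \<Rightarrow> 'b poly" where
  "weighted_matching_poly E d S =
     (\<Sum>M | matching E M \<and> \<Union>M \<subseteq> S. (-1) ^ card M * (\<Prod>v\<in>S - \<Union>M. [:- d v, 1:]))"

definition nbrs :: "'a set set \<Rightarrow> 'a set \<Rightarrow> 'a \<Rightarrow> 'a set" where
  "nbrs E S u = {w \<in> S. {u, w} \<in> E}"

lemma finite_nbrs [simp]: "finite S \<Longrightarrow> finite (nbrs E S u)"
  by (simp add: nbrs_def)

lemma finite_matchings_within:
  assumes "finite S"
  shows "finite {M. matching E M \<and> \<Union>M \<subseteq> S}"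
  by (rule finite_subset[of _ "Pow (Pow S)"]) (use assms in auto)

lemma weighted_matching_poly_empty [simp]:
  assumes "\<forall>e\<in>E. card e = 2"
  shows "weighted_matching_poly E d {} = 1"
proof -
  have "{M. matching E M \<and> \<Union>M \<subseteq> {}} = {{}}"
  proof (intro set_eqI iffI)
    fix M assume "M \<in> {M. matching E M \<and> \<Union>M \<subseteq> {}}"
    then have M: "M \<subseteq> E" "\<And>e. e \<in> M \<Longrightarrow> e = {}"
      by (auto simp: matching_def)
    have "e \<notin> M" for e
      using M(1) M(2)[of e] assms by force
    then show "M \<in> {{}}"
      by auto
  qed (auto simp: matching_def)
  then show ?thesis
    by (simp add: weighted_matching_poly_def)
qed

lemma weighted_matching_poly_cong:
  assumes "\<And>v. v \<in> S \<Longrightarrow> d v = d' v"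
    and "\<And>e. e \<subseteq> S \<Longrightarrow> e \<in> E \<longleftrightarrow> e \<in> E'"
  shows "weighted_matching_poly E d S = weighted_matching_poly E' d' S"
proof -
  have "M \<subseteq> E \<longleftrightarrow> M \<subseteq> E'" if "\<Union>M \<subseteq> S" for M
    using assms(2) that by (meson Union_upper subset_iff subset_trans)
  then have "{M. matching E M \<and> \<Union>M \<subseteq> S} = {M. matching E' M \<and> \<Union>M \<subseteq> S}"
    by (auto simp: matching_def)
  then show ?thesis
    unfolding weighted_matching_poly_def using assms(1)
    by (intro sum.cong arg_cong2[where f = "(*)"] prod.cong) auto
qed

text \<open>A matching that covers \<open>u\<close> does so by exactly one edge. The inverse map
  reads off the partner of \<open>u\<close> and removes that edge; disjointness keeps the remaining
  edges away from both of its ends.\<close>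

lemma matchings_covering_bij:
  assumes "\<forall>e\<in>E. card e = 2" "u \<in> S"
  shows "bij_betw (\<lambda>(w, M). insert {u, w} M)
           (SIGMA w:nbrs E (S - {u}) u. {M. matching E M \<and> \<Union>M \<subseteq> S - {u} - {w}})
           {M. matching E M \<and> \<Union>M \<subseteq> S \<and> u \<in> \<Union>M}"
    (is "bij_betw ?f ?A ?B")
proof (rule bij_betwI[where g = "\<lambda>M. (THE w. {u, w} \<in> M, M - {{u, THE w. {u, w} \<in> M}})"])
  have fst_eq: "(THE w. {u, w} \<in> M) = w"
    if "pairwise disjnt M" "{u, w} \<in> M" for M w
  proof (rule the_equality[where P = "\<lambda>w. {u, w} \<in> M"])
    fix w' assume "{u, w'} \<in> M"
    then have "{u, w} = {u, w'}"
      using that pairwiseD[OF that(1) that(2)] by (auto simp: disjnt_def)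
    then show "w' = w"
      by (auto simp: doubleton_eq_iff)
  qed (use that in auto)
  show f: "?f \<in> ?A \<rightarrow> ?B"
    using assms(2) by (fastforce simp: nbrs_def matching_def pairwise_insert disjnt_def)
  show "(\<lambda>M. (THE w. {u, w} \<in> M, M - {{u, THE w. {u, w} \<in> M}})) \<in> ?B \<rightarrow> ?A"
  proof
    fix M assume M: "M \<in> ?B"
    then obtain e where e: "e \<in> M" "u \<in> e"
      by auto
    then have "card e = 2"
      using M assms(1) by (auto simp: matching_def)
    then obtain w where w: "e = {u, w}" "w \<noteq> u"
      using e by (auto simp: card_2_iff)
    have "x \<notin> {u, w}" if "x \<in> e'" "e' \<in> M - {{u, w}}" for x e'
      using M that e w pairwiseD[of disjnt M e e'] by (auto simp: matching_def disjnt_def)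
    then have "\<Union>(M - {{u, w}}) \<subseteq> S - {u} - {w}"
      using M by auto
    moreover have "matching E (M - {{u, w}})"
      using M by (auto simp: matching_def pairwise_def)
    moreover have "w \<in> nbrs E (S - {u}) u"
      using M e w by (auto simp: matching_def nbrs_def)
    ultimately show "(THE w. {u, w} \<in> M, M - {{u, THE w. {u, w} \<in> M}}) \<in> ?A"
      using M e w fst_eq[of M w] by (auto simp: matching_def)
  qed
  show "(THE w. {u, w} \<in> ?f x, ?f x - {{u, THE w. {u, w} \<in> ?f x}}) = x" if x: "x \<in> ?A" for x
  proof -
    obtain w M where wM: "x = (w, M)"
      by force
    have "{u, w} \<notin> M"
      using x wM by auto
    moreover have "pairwise disjnt (?f x)"
      using funcset_mem[OF f x] by (simp add: matching_def)
    ultimately show ?thesis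
      using wM fst_eq[of "?f x" w] by auto
  qed
  show "?f (THE w. {u, w} \<in> M, M - {{u, THE w. {u, w} \<in> M}}) = M" if M: "M \<in> ?B" for M
  proof -
    obtain e where e: "e \<in> M" "u \<in> e"
      using M by auto
    then have "card e = 2"
      using M assms(1) by (auto simp: matching_def)
    then obtain w where w: "e = {u, w}" "w \<noteq> u"
      using e by (auto simp: card_2_iff)
    then show ?thesis
      using M e fst_eq[of M w] by (auto simp: matching_def)
  qed
qed

text \<open>Split the matchings by whether they cover \<open>u\<close>. If not, \<open>u\<close>
  contributes its linear factor; if so, removing the edge \<open>{u, w}\<close> flips the sign and
  deletes both ends.\<close>

lemma weighted_matching_poly_rec:
  assumes "\<forall>e\<in>E. card e = 2" "finite S" "u \<in> S"
  shows "weighted_matching_poly E d S =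
           [:- d u, 1:] * weighted_matching_poly E d (S - {u})
           - (\<Sum>w\<in>nbrs E (S - {u}) u. weighted_matching_poly E d (S - {u} - {w}))"
proof -
  define t where "t S M = (-1) ^ card M * (\<Prod>v\<in>S - \<Union>M. [:- d v, 1:])" for S M
  define A where "A S = {M. matching E M \<and> \<Union>M \<subseteq> S}" for S
  have wmp: "weighted_matching_poly E d S = sum (t S) (A S)" for S
    by (simp add: weighted_matching_poly_def t_def A_def)
  let ?B = "{M. matching E M \<and> \<Union>M \<subseteq> S \<and> u \<in> \<Union>M}"
  have fin: "finite (A S')" if "S' \<subseteq> S" for S'
    unfolding A_def using that assms(2) finite_matchings_within finite_subset by blast
  have split: "A S = A (S - {u}) \<union> ?B" "A (S - {u}) \<inter> ?B = {}"
    by (auto simp: A_def)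
  have "finite ?B"
    by (rule finite_subset[OF _ fin[of S]]) (auto simp: A_def)
  then have "sum (t S) (A S) = sum (t S) (A (S - {u})) + sum (t S) ?B"
    unfolding split(1) by (intro sum.union_disjoint fin split(2)) auto
  also have "sum (t S) (A (S - {u})) = (\<Sum>M\<in>A (S - {u}). [:- d u, 1:] * t (S - {u}) M)"
  proof (rule sum.cong)
    fix M assume "M \<in> A (S - {u})"
    then have "S - \<Union>M = insert u (S - {u} - \<Union>M)"
      using assms(3) by (auto simp: A_def)
    then have "(\<Prod>v\<in>S - \<Union>M. [:- d v, 1:]) = [:- d u, 1:] * (\<Prod>v\<in>S - {u} - \<Union>M. [:- d v, 1:])"
      using assms(2) by simp
    then show "t S M = [:- d u, 1:] * t (S - {u}) M"
      unfolding t_def by (simp only: mult.left_commute)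
  qed auto
  also have "sum (t S) ?B =
      (\<Sum>(w, M)\<in>(SIGMA w:nbrs E (S - {u}) u. A (S - {u} - {w})). t S (insert {u, w} M))"
    using sum.reindex_bij_betw[OF matchings_covering_bij[OF assms(1,3)], of "t S"]
    by (simp add: A_def case_prod_unfold)
  also have "\<dots> = (\<Sum>(w, M)\<in>(SIGMA w:nbrs E (S - {u}) u. A (S - {u} - {w})). - t (S - {u} - {w}) M)"
  proof (rule sum.cong, safe)
    fix w M assume "w \<in> nbrs E (S - {u}) u" "M \<in> A (S - {u} - {w})"
    then have "finite M" "{u, w} \<notin> M" "S - \<Union>(insert {u, w} M) = S - {u} - {w} - \<Union>M"
      using assms(2) by (auto simp: A_def intro: finite_subset[of M "Pow S"])
    then show "t S (insert {u, w} M) = - t (S - {u} - {w}) M"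
      by (simp add: t_def)
  qed
  also have "\<dots> = (\<Sum>w\<in>nbrs E (S - {u}) u. \<Sum>M\<in>A (S - {u} - {w}). - t (S - {u} - {w}) M)"
    using assms(2) by (intro sum.Sigma[symmetric]) (auto intro: fin)
  finally show ?thesis
    by (simp add: wmp sum_distrib_left sum_negf)
qed

text \<open>In the recurrence at \<open>u\<close> the weight of \<open>u\<close> enters only through
  the linear factor.\<close>

lemma weighted_matching_poly_increase_weight:
  assumes "\<forall>e\<in>E. card e = 2" "finite S" "u \<in> S"
  shows "weighted_matching_poly E (d(u := d u + 1)) S =
           weighted_matching_poly E d S - weighted_matching_poly E d (S - {u})"
proof -
  have "weighted_matching_poly E (d(u := d u + 1)) (S - {u} - T) =
        weighted_matching_poly E d (S - {u} - T)" for T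
    by (rule weighted_matching_poly_cong) auto
  from this this[of "{}"] show ?thesis
    by (simp add: weighted_matching_poly_rec[OF assms] smult_diff_left algebra_simps)
qed

text \<open>The recurrence at \<open>u\<close> gains a single term, for the new neighbour
  \<open>v\<close>; all other terms live on sets without \<open>u\<close>, where the new edge is
  invisible.\<close>

lemma weighted_matching_poly_insert_edge:
  assumes "\<forall>e\<in>E. card e = 2" "finite S" "u \<in> S" "v \<in> S" "u \<noteq> v" "{u, v} \<notin> E"
  shows "weighted_matching_poly (insert {u, v} E) d S =
           weighted_matching_poly E d S - weighted_matching_poly E d (S - {u} - {v})"
proof -
  have E': "\<forall>e\<in>insert {u, v} E. card e = 2"
    using assms by auto
  have eq: "weighted_matching_poly (insert {u, v} E) d (S - {u} - T) =
        weighted_matching_poly E d (S - {u} - T)" for T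
    by (rule weighted_matching_poly_cong) auto
  have "nbrs (insert {u, v} E) (S - {u}) u = insert v (nbrs E (S - {u}) u)"
    using assms by (auto simp: nbrs_def doubleton_eq_iff)
  moreover have "v \<notin> nbrs E (S - {u}) u"
    using assms by (auto simp: nbrs_def)
  ultimately show ?thesis
    using eq[of "{}"] assms(2)
    by (simp add: weighted_matching_poly_rec[OF E' assms(2,3)]
        weighted_matching_poly_rec[OF assms(1-3)] eq algebra_simps)
qed

section \<open>The Laplacian matching polynomial and the effect of a new edge\<close>

lemma laplacian_matching_poly_eq_weighted:
  assumes "simple_graph V E"
  shows "(laplacian_matching_poly V E :: 'b :: comm_ring_1 poly) =
           weighted_matching_poly E (\<lambda>v. of_nat (degree_of E v)) V"
proof -
  have "{M. matching E M} = {M. matching E M \<and> \<Union>M \<subseteq> V}"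
    using assms by (auto simp: matching_def simple_graph_def)
  then show ?thesis
    by (simp add: laplacian_matching_poly_def weighted_matching_poly_def)
qed

lemma simple_graph_finite_edges:
  assumes "simple_graph V E"
  shows "finite E"
  by (rule finite_subset[of _ "Pow V"]) (use assms in \<open>auto simp: simple_graph_def\<close>)

lemma degree_of_insert_edge:
  assumes "finite E" "e \<notin> E"
  shows "degree_of (insert e E) v = degree_of E v + (if v \<in> e then 1 else 0)"
proof -
  have "{e' \<in> insert e E. v \<in> e'} = (if v \<in> e then insert e {e' \<in> E. v \<in> e'} else {e' \<in> E. v \<in> e'})"
    by auto
  then show ?thesis
    using assms by (simp add: degree_of_def)
qed

text \<open>Raising the weights of both ends of the new edge produces a term for deleting
  both ends, which the matchings through the new edge cancel.\<close>

lemma laplacian_matching_poly_insert_edge: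
  fixes V :: "'a set" and d :: "'a \<Rightarrow> 'b :: comm_ring_1"
  assumes "simple_graph V E" "u \<in> V" "v \<in> V" "u \<noteq> v" "{u, v} \<notin> E"
    and d_def: "d = (\<lambda>v. of_nat (degree_of E v))"
  shows "laplacian_matching_poly V (insert {u, v} E) =
           weighted_matching_poly E d V - weighted_matching_poly E d (V - {u})
           - weighted_matching_poly E d (V - {v})"
proof -
  have fin: "finite V" and E: "\<forall>e\<in>E. card e = 2"
    using assms(1) by (auto simp: simple_graph_def)
  define d1 where "d1 = d(u := d u + 1)"
  define d2 where "d2 = d1(v := d1 v + 1)"
  have sg: "simple_graph V (insert {u, v} E)"
    using assms by (auto simp: simple_graph_def)
  have "(\<lambda>w. of_nat (degree_of (insert {u, v} E) w)) = d2"
    using degree_of_insert_edge[OF simple_graph_finite_edges[OF assms(1)] assms(5)] assms(4)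
    by (auto simp: d2_def d1_def d_def fun_eq_iff)
  then have "laplacian_matching_poly V (insert {u, v} E) =
      weighted_matching_poly E d2 V - weighted_matching_poly E d2 (V - {u} - {v})"
    using laplacian_matching_poly_eq_weighted[OF sg]
      weighted_matching_poly_insert_edge[OF E fin assms(2-5)] by metis
  also have "weighted_matching_poly E d2 V =
      weighted_matching_poly E d1 V - weighted_matching_poly E d1 (V - {v})"
    unfolding d2_def by (rule weighted_matching_poly_increase_weight[OF E fin assms(3)])
  also have "weighted_matching_poly E d1 V =
      weighted_matching_poly E d V - weighted_matching_poly E d (V - {u})"
    unfolding d1_def by (rule weighted_matching_poly_increase_weight[OF E fin assms(2)])
  also have "weighted_matching_poly E d1 (V - {v}) =
      weighted_matching_poly E d (V - {v}) - weighted_matching_poly E d (V - {v} - {u})"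
    unfolding d1_def using fin assms by (intro weighted_matching_poly_increase_weight[OF E]) auto
  \<comment> \<open>Neither end is left in the set, so the raised weights agree with
    \<open>d\<close> there; the substitutions only exchange the order of the two deletions.\<close>
  also have "weighted_matching_poly E d2 (V - {u} - {v}) = weighted_matching_poly E d (V - {v} - {u})"
    by (subst Diff_insert2[symmetric], subst Diff_insert2[symmetric], subst insert_commute,
        rule weighted_matching_poly_cong) (auto simp: d1_def d2_def)
  finally show ?thesis
    by simp
qed


section \<open>Expansion at infinity\<close>

text \<open>For \<open>degree p \<le> n\<close> this is \<open>y ^ n * p (1 / y)\<close>.\<close>

definition rev_fps :: "nat \<Rightarrow> 'b :: comm_ring_1 poly \<Rightarrow> 'b fps" where
  "rev_fps n p = Abs_fps (\<lambda>i. if i \<le> n then coeff p (n - i) else 0)"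

lemma rev_fps_add: "rev_fps n (p + q) = rev_fps n p + rev_fps n q"
  by (simp add: rev_fps_def fps_eq_iff)

lemma rev_fps_diff: "rev_fps n (p - q) = rev_fps n p - rev_fps n q"
  by (simp add: rev_fps_def fps_eq_iff)

lemma rev_fps_sum: "rev_fps n (\<Sum>x\<in>A. f x) = (\<Sum>x\<in>A. rev_fps n (f x))"
  by (simp add: rev_fps_def fps_eq_iff fps_sum_nth coeff_sum)

text \<open>Reversal is multiplicative: \<open>y ^ (n + 1)\<close> times
  \<open>(a + b / y) * p (1 / y)\<close> splits as \<open>(b + a * y)\<close> times
  \<open>y ^ n * p (1 / y)\<close>. The degree bound ensures that no coefficient of \<open>p\<close>
  is cut off.\<close>

lemma rev_fps_linear_mult:
  assumes "degree p \<le> n"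
  shows "rev_fps (Suc n) ([:a, b:] * p) = (fps_const b + fps_const a * fps_X) * rev_fps n p"
proof (rule fps_ext)
  fix i
  have "coeff p (Suc n) = 0"
    using assms by (simp add: coeff_eq_0)
  then show "rev_fps (Suc n) ([:a, b:] * p) $ i =
      ((fps_const b + fps_const a * fps_X) * rev_fps n p) $ i"
    by (cases i) (auto simp: rev_fps_def distrib_right mult.assoc coeff_pCons Suc_diff_le
        diff_Suc split: nat.split)
qed

lemma rev_fps_Suc_Suc:
  assumes "degree p \<le> n"
  shows "rev_fps (Suc (Suc n)) p = fps_X ^ 2 * rev_fps n p"
proof (rule fps_ext)
  fix i
  have "coeff p (Suc (Suc n) - i) = 0" if "i < 2"
    using assms that by (intro coeff_eq_0) linarith
  moreover have "Suc (Suc n) - i = n - (i - 2)" "i \<le> Suc (Suc n) \<longleftrightarrow> i - 2 \<le> n" if "\<not> i < 2"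
    using that by linarith+
  ultimately show "rev_fps (Suc (Suc n)) p $ i = (fps_X ^ 2 * rev_fps n p) $ i"
    by (simp add: rev_fps_def fps_X_power_mult_nth)
qed

text \<open>The leading term is that of the empty matching. Being monic makes the reversed
  polynomial start with 1, hence invertible as a power series.\<close>

lemma monic_weighted_matching_poly:
  assumes "\<forall>e\<in>E. card e = 2" "finite S"
  shows "degree (weighted_matching_poly E d S) \<le> card S \<and>
         coeff (weighted_matching_poly E d S) (card S) = 1"
  using assms(2)
\<comment> \<open>Strong induction, because the recurrence refers to sets with one and with two
  elements fewer.\<close>
proof (induction "card S" arbitrary: S rule: less_induct)
  case less
  show ?case
  proof (cases "S = {}")
    case True
    then show ?thesis
      using assms(1) by simp
  next
    case False
    then obtain u where u: "u \<in> S"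
      by auto
    define n where "n = card (S - {u})"
    define p where "p = weighted_matching_poly E d (S - {u})"
    have n: "card S = Suc n"
      unfolding n_def by (rule card.remove[OF less.prems u])
    have p: "degree p \<le> n" "coeff p n = 1"
      using less.hyps[of "S - {u}"] n less.prems by (auto simp: n_def p_def)
    have q: "degree (weighted_matching_poly E d (S - {u} - {w})) \<le> n"
      if "w \<in> nbrs E (S - {u}) u" for w
    proof -
      have "card (S - {u} - {w}) < n"
        using that less.prems unfolding n_def by (intro card_Diff1_less) (auto simp: nbrs_def)
      then show ?thesis
        using less.hyps[of "S - {u} - {w}"] n less.prems by auto
    qed
    define q where "q = (\<Sum>w\<in>nbrs E (S - {u}) u. weighted_matching_poly E d (S - {u} - {w}))"
    have qd: "degree q \<le> n"
      unfolding q_def using less.prems q by (intro degree_sum_le) auto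
    have eq: "weighted_matching_poly E d S = [:- d u, 1:] * p - q"
      unfolding p_def q_def by (rule weighted_matching_poly_rec[OF assms(1) less.prems u])
    have "degree ([:- d u, 1:] * p) \<le> Suc n"
      using degree_mult_le[of "[:- d u, 1:]" p] p(1) by simp
    then have "degree (weighted_matching_poly E d S) \<le> Suc n"
      unfolding eq using qd by (intro degree_diff_le) auto
    moreover have "coeff (weighted_matching_poly E d S) (Suc n) = 1"
      using p qd by (simp add: eq coeff_eq_0)
    ultimately show ?thesis
      by (simp add: n)
  qed
qed

section \<open>Reversed matching polynomials and the continued fraction of their quotients\<close>

definition rev_matching :: "'a set set \<Rightarrow> ('a \<Rightarrow> 'b :: comm_ring_1) \<Rightarrow> 'a set \<Rightarrow> 'b fps" where
  "rev_matching E d S = rev_fps (card S) (weighted_matching_poly E d S)"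

lemma rev_matching_nth_0:
  assumes "\<forall>e\<in>E. card e = 2" "finite S"
  shows "rev_matching E d S $ 0 = 1"
  using monic_weighted_matching_poly[OF assms, of d] by (simp add: rev_matching_def rev_fps_def)

text \<open>The terms with two vertices deleted are reversed at a size smaller by two, which
  accounts for the factor \<open>fps_X ^ 2\<close>.\<close>

lemma rev_matching_rec:
  assumes "\<forall>e\<in>E. card e = 2" "finite S" "u \<in> S"
  shows "rev_matching E d S = (1 - fps_const (d u) * fps_X) * rev_matching E d (S - {u})
           - fps_X ^ 2 * (\<Sum>w\<in>nbrs E (S - {u}) u. rev_matching E d (S - {u} - {w}))"
proof -
  have "card S = Suc (card (S - {u}))"
    by (rule card.remove[OF assms(2,3)])
  moreover have "rev_fps (Suc (card (S - {u}))) (weighted_matching_poly E d (S - {u} - {w})) =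
      fps_X ^ 2 * rev_matching E d (S - {u} - {w})" if "w \<in> nbrs E (S - {u}) u" for w
  proof -
    have "card (S - {u}) = Suc (card (S - {u} - {w}))"
      using assms that by (intro card.remove) (auto simp: nbrs_def)
    then show ?thesis
      using monic_weighted_matching_poly[OF assms(1), of "S - {u} - {w}" d] assms(2)
      by (simp add: rev_matching_def rev_fps_Suc_Suc)
  qed
  ultimately show ?thesis
    using assms(2) monic_weighted_matching_poly[OF assms(1), of "S - {u}" d]
    by (simp add: rev_matching_def weighted_matching_poly_rec[OF assms] rev_fps_diff rev_fps_sum
        rev_fps_linear_mult sum_distrib_left del: mult_pCons_left flip: fps_const_neg)
qed

text \<open>The coefficients of this quotient count the tree-like closed walks at \<open>u\<close>.\<close>

definition walk_fps :: "'a set set \<Rightarrow> ('a \<Rightarrow> 'b :: field) \<Rightarrow> 'a set \<Rightarrow> 'a \<Rightarrow> 'b fps" where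
  "walk_fps E d S u = rev_matching E d (S - {u}) * inverse (rev_matching E d S)"

text \<open>This is the vertex recurrence divided by the series of \<open>S\<close>: each product of
  the quotient at \<open>u\<close> with a quotient at \<open>w\<close> telescopes, since the series
  of \<open>S - {u}\<close> cancels.\<close>

lemma walk_fps_continued_fraction:
  assumes "\<forall>e\<in>E. card e = 2" "finite S" "u \<in> S"
  shows "walk_fps E d S u *
    (1 - fps_const (d u) * fps_X - fps_X ^ 2 * (\<Sum>w\<in>nbrs E (S - {u}) u. walk_fps E d (S - {u}) w)) = 1"
proof -
  define r where "r = rev_matching E d"
  have inv: "r S' * inverse (r S') = 1" if "finite S'" for S'
    using inverse_mult_eq_1'[of "r S'"] rev_matching_nth_0[OF assms(1) that, of d]
    by (simp add: r_def)
  have cancel: "r (S - {u}) * inverse (r S) * (r (S - {u} - {w}) * inverse (r (S - {u})))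
      = inverse (r S) * r (S - {u} - {w})" for w
  proof -
    have "r (S - {u}) * inverse (r S) * (r (S - {u} - {w}) * inverse (r (S - {u})))
        = r (S - {u}) * inverse (r (S - {u})) * (inverse (r S) * r (S - {u} - {w}))"
      by (simp only: mult_ac)
    then show ?thesis
      using inv[of "S - {u}"] assms(2) by simp
  qed
  have "walk_fps E d S u *
      (1 - fps_const (d u) * fps_X - fps_X ^ 2 * (\<Sum>w\<in>nbrs E (S - {u}) u. walk_fps E d (S - {u}) w))
    = r (S - {u}) * inverse (r S) * (1 - fps_const (d u) * fps_X)
      - fps_X ^ 2 * (\<Sum>w\<in>nbrs E (S - {u}) u. r (S - {u}) * inverse (r S) *
          (r (S - {u} - {w}) * inverse (r (S - {u}))))"
    by (simp add: walk_fps_def r_def sum_distrib_left algebra_simps)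
  also have "\<dots> = inverse (r S) * ((1 - fps_const (d u) * fps_X) * r (S - {u})
      - fps_X ^ 2 * (\<Sum>w\<in>nbrs E (S - {u}) u. r (S - {u} - {w})))"
    unfolding cancel by (simp add: sum_distrib_left algebra_simps)
  also have "\<dots> = inverse (r S) * r S"
    using rev_matching_rec[OF assms, of d] by (simp add: r_def)
  finally show ?thesis
    using inv[OF assms(2)] by (simp add: mult.commute)
qed

lemma walk_fps_nth:
  fixes d :: "'a \<Rightarrow> 'b :: field"
  assumes "\<forall>e\<in>E. card e = 2" "finite S" "u \<in> S"
  defines "F \<equiv> \<Sum>w\<in>nbrs E (S - {u}) u. walk_fps E d (S - {u}) w"
  shows "walk_fps E d S u $ 0 = 1"
    and "walk_fps E d S u $ 1 = d u"
    and "walk_fps E d S u $ 2 = d u ^ 2 + F $ 0"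
    and "walk_fps E d S u $ 3 = d u ^ 3 + 2 * d u * F $ 0 + F $ 1"
    and "walk_fps E d S u $ 4 = d u ^ 4 + 3 * d u ^ 2 * F $ 0 + 2 * d u * F $ 1 + (F $ 0) ^ 2 + F $ 2"
proof -
  define R where "R = walk_fps E d S u"
  \<comment> \<open>In this fixed-point form each coefficient of \<open>R\<close> is determined by
    earlier ones and by \<open>F\<close>.\<close>
  have "R = 1 + fps_X * (fps_const (d u) * R) + fps_X ^ 2 * (F * R)"
    using walk_fps_continued_fraction[OF assms(1-3), of d]
    by (simp add: R_def F_def algebra_simps)
  then have "R $ n = (1 + fps_X * (fps_const (d u) * R) + fps_X ^ 2 * (F * R)) $ n" for n
    by simp
  then have R: "R $ n = (if n = 0 then 1 else d u * R $ (n - 1))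
      + (if n < 2 then 0 else (F * R) $ (n - 2))" for n
    by (simp add: fps_X_power_mult_nth)
  show 0: "walk_fps E d S u $ 0 = 1"
    using R[of 0] by (simp add: R_def)
  show 1: "walk_fps E d S u $ 1 = d u"
    using R[of 1] 0 by (simp add: R_def)
  show 2: "walk_fps E d S u $ 2 = d u ^ 2 + F $ 0"
    using R[of 2] 0 1 by (simp add: R_def power2_eq_square)
  show 3: "walk_fps E d S u $ 3 = d u ^ 3 + 2 * d u * F $ 0 + F $ 1"
    using R[of 3] 0 1 2
    by (simp add: R_def fps_mult_nth_1 power2_eq_square power3_eq_cube algebra_simps)
  have "(F * R) $ 2 = F $ 0 * R $ 2 + F $ 1 * R $ 1 + F $ 2 * R $ 0"
    by (simp add: fps_mult_nth numeral_2_eq_2)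
  then show "walk_fps E d S u $ 4 =
      d u ^ 4 + 3 * d u ^ 2 * F $ 0 + 2 * d u * F $ 1 + (F $ 0) ^ 2 + F $ 2"
    using R[of 4] 0 1 2 3
    by (simp add: R_def power2_eq_square power3_eq_cube power4_eq_xxxx algebra_simps)
qed

section \<open>The first walk coefficients for Laplacian weights\<close>

lemma card_nbrs:
  assumes "simple_graph V E" "w \<in> V"
  shows "card (nbrs E V w) = degree_of E w"
proof -
  have "bij_betw (\<lambda>x. {w, x}) (nbrs E V w) {e \<in> E. w \<in> e}"
  proof (rule bij_betw_imageI)
    show "inj_on (\<lambda>x. {w, x}) (nbrs E V w)"
      by (auto simp: inj_on_def doubleton_eq_iff)
    show "(\<lambda>x. {w, x}) ` nbrs E V w = {e \<in> E. w \<in> e}"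
    proof (intro set_eqI iffI)
      fix e assume e: "e \<in> {e \<in> E. w \<in> e}"
      then have "card e = 2" "e \<subseteq> V"
        using assms by (auto simp: simple_graph_def)
      then obtain x where "e = {w, x}"
        using e by (auto simp: card_2_iff)
      then show "e \<in> (\<lambda>x. {w, x}) ` nbrs E V w"
        using e \<open>e \<subseteq> V\<close> by (auto simp: nbrs_def)
    qed (auto simp: nbrs_def)
  qed
  then show ?thesis
    by (simp add: bij_betw_same_card degree_of_def)
qed

lemma self_notin_nbrs:
  assumes "simple_graph V E"
  shows "w \<notin> nbrs E S w"
  using assms by (auto simp: simple_graph_def nbrs_def)

text \<open>Two levels of the continued fraction suffice up to index 4. On the second level a
  neighbour \<open>w\<close> keeps the weight \<open>d w\<close> but has lost its neighbour
  \<open>u\<close>, so \<open>d w - 1\<close> neighbours remain; this is the source of the term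
  \<open>- d u\<close> in the last coefficient.\<close>

lemma walk_fps_laplacian_nth:
  fixes V :: "'a set" and d :: "'a \<Rightarrow> 'b :: field"
  assumes "simple_graph V E" "u \<in> V" and d_def: "d = (\<lambda>v. of_nat (degree_of E v))"
  defines "s \<equiv> \<Sum>w\<in>nbrs E V u. d w"
  shows "walk_fps E d V u $ 0 = 1"
    and "walk_fps E d V u $ 1 = d u"
    and "walk_fps E d V u $ 2 = d u ^ 2 + d u"
    and "walk_fps E d V u $ 3 = d u ^ 3 + 2 * d u ^ 2 + s"
    and "walk_fps E d V u $ 4 = d u ^ 4 + 3 * d u ^ 3 + d u ^ 2 - d u + (2 * d u + 1) * s
           + (\<Sum>w\<in>nbrs E V u. d w ^ 2)"
proof -
  have fin: "finite V" and E: "\<forall>e\<in>E. card e = 2"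
    using assms(1) by (auto simp: simple_graph_def)
  define F where "F = (\<Sum>w\<in>nbrs E (V - {u}) u. walk_fps E d (V - {u}) w)"
  have N: "nbrs E (V - {u}) u = nbrs E V u"
    using self_notin_nbrs[OF assms(1)] by (fastforce simp: nbrs_def)
  have w: "walk_fps E d (V - {u}) w $ 0 = 1" "walk_fps E d (V - {u}) w $ 1 = d w"
    "walk_fps E d (V - {u}) w $ 2 = d w ^ 2 + d w - 1" if "w \<in> nbrs E V u" for w
  proof -
    have wV: "w \<in> V - {u}"
      using that N by (auto simp: nbrs_def)
    have fin': "finite (V - {u})"
      using fin by simp
    note nth = walk_fps_nth[OF E fin' wV, of d]
    show "walk_fps E d (V - {u}) w $ 0 = 1" "walk_fps E d (V - {u}) w $ 1 = d w"
      by (rule nth)+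
    have "u \<in> nbrs E V w" "nbrs E (V - {u} - {w}) w = nbrs E V w - {u}"
      using that assms(2) self_notin_nbrs[OF assms(1)] by (fastforce simp: nbrs_def insert_commute)+
    moreover from this have "card (nbrs E V w) = Suc (card (nbrs E V w - {u}))"
      using fin by (intro card.remove) auto
    ultimately have "d w = of_nat (card (nbrs E (V - {u} - {w}) w)) + 1"
      using card_nbrs[OF assms(1), of w] wV by (simp add: d_def)
    moreover have "walk_fps E d (V - {u} - {w}) x $ 0 = 1" if "x \<in> nbrs E (V - {u} - {w}) w" for x
      using that fin by (intro walk_fps_nth[OF E]) (auto simp: nbrs_def)
    ultimately show "walk_fps E d (V - {u}) w $ 2 = d w ^ 2 + d w - 1"
      by (simp add: nth(3) fps_sum_nth)
  qed
  have F: "F $ 0 = d u" "F $ 1 = s" "F $ 2 = (\<Sum>w\<in>nbrs E V u. d w ^ 2) + s - d u"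
    using card_nbrs[OF assms(1,2)] w(1,3) w(2)[unfolded One_nat_def]
    by (simp_all add: F_def N fps_sum_nth d_def s_def sum.distrib sum_subtractf)
  note nth = walk_fps_nth[OF E fin assms(2), of d, folded F_def, unfolded F]
  show "walk_fps E d V u $ 0 = 1" "walk_fps E d V u $ 1 = d u"
    "walk_fps E d V u $ 2 = d u ^ 2 + d u"
    by (rule nth)+
  show "walk_fps E d V u $ 3 = d u ^ 3 + 2 * d u ^ 2 + s"
    using nth(4) by (simp add: power2_eq_square)
  show "walk_fps E d V u $ 4 = d u ^ 4 + 3 * d u ^ 3 + d u ^ 2 - d u + (2 * d u + 1) * s
           + (\<Sum>w\<in>nbrs E V u. d w ^ 2)"
    using nth(5) by (simp add: power2_eq_square power3_eq_cube algebra_simps)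
qed

section \<open>Integral variation in two places\<close>

text \<open>The quotient identity of the overview, written in \<open>1 / x\<close> and cleared of
  its quadratic denominator.\<close>

lemma LMRIV_two_places_walk_fps:
  fixes V :: "'a set" and d :: "'a \<Rightarrow> complex"
  assumes "simple_graph V E" "u \<in> V" "v \<in> V" "u \<noteq> v" "{u, v} \<notin> E" "LMRIV_two_places V E {u, v}"
    and d_def: "d = (\<lambda>v. of_nat (degree_of E v))"
  obtains a b where
    "(1 - fps_const a * fps_X) * ((1 - fps_const b * fps_X) * (walk_fps E d V u + walk_fps E d V v))
      = 2 - fps_const (a + b + 1) * fps_X"
proof -
  have fin: "finite V" and E: "\<forall>e\<in>E. card e = 2"
    using assms(1) by (auto simp: simple_graph_def)
  obtain A a b where roots: "laplacian_matching_roots V E = A + {#a, b#}"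
    "laplacian_matching_roots V (insert {u, v} E) = A + {#a + 1, b + 1#}"
    using assms(6) by (auto simp: LMRIV_two_places_def)
  define P :: "complex poly" where "P = (\<Prod>x\<in>#A. [:-x, 1:])"
  define m where "m = weighted_matching_poly E d"
  \<comment> \<open>A monic complex polynomial is recovered from its root multiset, so the relation
    between the multisets becomes one between polynomials with common factor
    \<open>P\<close>.\<close>
  have factor: "laplacian_matching_poly V E' = (\<Prod>x\<in>#laplacian_matching_roots V E'. [:-x, 1:])"
    if sg: "simple_graph V E'" for E'
  proof -
    let ?p = "laplacian_matching_poly V E' :: complex poly"
    have "\<forall>e\<in>E'. card e = 2"
      using sg by (auto simp: simple_graph_def)
    then have p: "degree ?p \<le> card V" "coeff ?p (card V) = 1"
      using monic_weighted_matching_poly[of E' V] laplacian_matching_poly_eq_weighted[OF sg] fin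
      by metis+
    then have "degree ?p = card V"
      by (metis le_antisym le_degree zero_neq_one)
    then show ?thesis
      using complex_poly_decompose_multiset[of ?p] p by (simp add: laplacian_matching_roots_def)
  qed
  have V: "m V = [:-a, 1:] * ([:-b, 1:] * P)"
    using factor[OF assms(1)] laplacian_matching_poly_eq_weighted[OF assms(1), where ?'b = complex]
    unfolding roots m_def d_def P_def by (simp add: mult_ac)
  have sg: "simple_graph V (insert {u, v} E)"
    using assms by (auto simp: simple_graph_def)
  have V': "m V - m (V - {u}) - m (V - {v}) = [:-a - 1, 1:] * ([:-b - 1, 1:] * P)"
    using factor[OF sg] laplacian_matching_poly_insert_edge[OF assms(1-5) d_def]
    unfolding roots m_def d_def P_def by (simp add: mult_ac)
  \<comment> \<open>Shifting both roots by 1 changes the quadratic by a linear polynomial.\<close>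
  have "[:-a - 1, 1:] * [:-b - 1, 1:] = [:-a, 1:] * [:-b, 1:] - [:- (a + b + 1), 2:]"
    by (simp add: algebra_simps)
  then have "[:-a - 1, 1:] * ([:-b - 1, 1:] * P)
      = ([:-a, 1:] * [:-b, 1:] - [:- (a + b + 1), 2:]) * P"
    by (metis mult.assoc)
  also have "\<dots> = m V - [:- (a + b + 1), 2:] * P"
    by (simp only: V left_diff_distrib mult.assoc)
  finally have "m (V - {u}) + m (V - {v}) = [:- (a + b + 1), 2:] * P"
    using V' by (simp add: algebra_simps)
  \<comment> \<open>Multiplying by the quadratic factor completes \<open>P\<close> to
    \<open>m V\<close>, which eliminates the unknown roots in \<open>A\<close>.\<close>
  then have "[:-a, 1:] * ([:-b, 1:] * (m (V - {u}) + m (V - {v})))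
      = [:- (a + b + 1), 2:] * m V"
    unfolding V by (simp only: mult_ac)
  then have eq: "rev_fps (Suc (card V)) ([:-a, 1:] * ([:-b, 1:] * (m (V - {u}) + m (V - {v}))))
      = rev_fps (Suc (card V)) ([:- (a + b + 1), 2:] * m V)"
    by simp
  obtain n where n: "card V = Suc n"
    using fin assms(2) by (metis card_Suc_Diff1)
  have cards: "card (V - {u}) = n" "card (V - {v}) = n"
    using n fin assms by auto
  have deg: "degree (m S) \<le> card S" if "S \<subseteq> V" for S
    using monic_weighted_matching_poly[OF E finite_subset[OF that fin], of d] by (simp add: m_def)
  have deg1: "degree (m (V - {u}) + m (V - {v})) \<le> n"
    using deg[of "V - {u}"] deg[of "V - {v}"] cards by (intro degree_add_le) auto
  then have deg2: "degree ([:-b, 1:] * (m (V - {u}) + m (V - {v}))) \<le> Suc n"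
    using degree_mult_le[of "[:-b, 1:]" "m (V - {u}) + m (V - {v})"] by simp
  define r where "r = rev_matching E d"
  have "(1 - fps_const a * fps_X) * ((1 - fps_const b * fps_X) * (r (V - {u}) + r (V - {v})))
      = (2 - fps_const (a + b + 1) * fps_X) * r V"
  proof -
    have "fps_const x + fps_const (- y) * fps_X = fps_const x - fps_const y * fps_X"
        "1 + fps_const (- y) * fps_X = 1 - fps_const y * fps_X" for x y :: complex
      by (simp_all flip: fps_const_neg)
    moreover have "rev_fps n (m (V - {u})) = r (V - {u})" "rev_fps n (m (V - {v})) = r (V - {v})"
        "rev_fps (Suc n) (m V) = r V"
      by (simp_all only: r_def rev_matching_def m_def cards n)
    ultimately show ?thesis
      using eq deg[of V] unfolding n rev_fps_linear_mult[OF deg2] rev_fps_linear_mult[OF deg1]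
      by (simp only: rev_fps_linear_mult rev_fps_add numeral_fps_const fps_const_1_eq_1 subset_refl)
  qed
  then have "(1 - fps_const a * fps_X) * ((1 - fps_const b * fps_X) * (r (V - {u}) + r (V - {v})))
      * inverse (r V) = (2 - fps_const (a + b + 1) * fps_X) * (r V * inverse (r V))"
    by (simp only: mult.assoc)
  moreover have "r V * inverse (r V) = 1"
    using inverse_mult_eq_1'[of "r V"] rev_matching_nth_0[OF E fin, of d] by (simp add: r_def)
  ultimately have "(1 - fps_const a * fps_X) * ((1 - fps_const b * fps_X) *
      (walk_fps E d V u + walk_fps E d V v)) = 2 - fps_const (a + b + 1) * fps_X"
    by (simp add: walk_fps_def r_def mult.assoc distrib_right)
  then show ?thesis
    by (rule that)
qed

text \<open>The right-hand side has degree at most one, so from index 2 on the coefficients satisfy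
  the homogeneous recurrence with characteristic roots \<open>a\<close> and \<open>b\<close>; index
  1 still sees the numerator.\<close>

lemma second_order_recurrence:
  fixes H :: "'b :: comm_ring_1 fps"
  assumes "(1 - fps_const a * fps_X) * ((1 - fps_const b * fps_X) * H)
      = 2 - fps_const (a + b + 1) * fps_X"
  shows "H $ 1 = (a + b) * H $ 0 - (a + b + 1)"
    and "H $ (n + 2) = (a + b) * H $ (n + 1) - a * b * H $ n"
proof -
  have H: "H = fps_const 2 - fps_X * fps_const (a + b + 1) + fps_X * (fps_const (a + b) * H)
      - fps_X ^ 2 * (fps_const (a * b) * H)"
    using assms
    by (simp add: numeral_fps_const power2_eq_square algebra_simps flip: fps_const_add fps_const_mult)
  show "H $ 1 = (a + b) * H $ 0 - (a + b + 1)"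
    by (subst H) (simp add: fps_X_power_mult_nth)
  show "H $ (n + 2) = (a + b) * H $ (n + 1) - a * b * H $ n"
    by (subst H) (simp add: fps_X_power_mult_nth)
qed

text \<open>A path from \<open>u\<close> to a different vertex has a first edge, and that edge
  contains \<open>u\<close>.\<close>

lemma connected_graph_degree_pos:
  assumes "simple_graph V E" "connected_graph V E" "u \<in> V" "v \<in> V" "u \<noteq> v"
  shows "degree_of E u > 0"
proof -
  have "(\<lambda>x y. {x, y} \<in> E)\<^sup>*\<^sup>* u v"
    using assms by (auto simp: connected_graph_def)
  then obtain w where "{u, w} \<in> E"
    using assms(5) by (auto elim: converse_rtranclpE)
  then show ?thesis
    using simple_graph_finite_edges[OF assms(1)] by (auto simp: degree_of_def card_gt_0_iff)
qed

lemma not_LMRIV_two_places: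
  fixes V :: "'a set" and E :: "'a set set"
  assumes "simple_graph V E" "u \<in> V" "v \<in> V" "u \<noteq> v" "{u, v} \<notin> E"
    and "degree_of E u > 0" "degree_of E v > 0"
  shows "\<not> LMRIV_two_places V E {u, v}"
proof
  assume "LMRIV_two_places V E {u, v}"
  define d where "d = (\<lambda>v. of_nat (degree_of E v) :: complex)"
  obtain a b where ab: "(1 - fps_const a * fps_X) * ((1 - fps_const b * fps_X) *
      (walk_fps E d V u + walk_fps E d V v)) = 2 - fps_const (a + b + 1) * fps_X"
    using LMRIV_two_places_walk_fps[OF assms(1-5) \<open>LMRIV_two_places V E {u, v}\<close> d_def]
    by blast
  define p q where "p = d u" and "q = d v"
  define su sv where "su = (\<Sum>w\<in>nbrs E V u. d w)" and "sv = (\<Sum>w\<in>nbrs E V v. d w)"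
  define tu tv where "tu = (\<Sum>w\<in>nbrs E V u. d w ^ 2)" and "tv = (\<Sum>w\<in>nbrs E V v. d w ^ 2)"
  note wu = walk_fps_laplacian_nth[OF assms(1,2) d_def, folded p_def su_def tu_def]
  note wv = walk_fps_laplacian_nth[OF assms(1,3) d_def, folded q_def sv_def tv_def]
  note rec = second_order_recurrence(2)[OF ab]
  \<comment> \<open>The sum of the two walk series has coefficients 2 and \<open>p + q\<close> at
    indices 0 and 1; the 2 also appears in the next comparison.\<close>
  have "p + q = a + b - 1"
    using second_order_recurrence(1)[OF ab] wu(1,2) wv(1,2) by (simp add: algebra_simps)
  then have s: "a + b = p + q + 1"
    by (simp add: algebra_simps)
  have "p ^ 2 + p + (q ^ 2 + q) = (p + q + 1) * (p + q) - a * b * 2"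
    using rec[of 0] wu(1-3) wv(1-3) s by (simp add: numeral_2_eq_2)
  then have t: "a * b = p * q"
    by (simp add: power2_eq_square algebra_simps)
  have "p ^ 3 + 2 * p ^ 2 + su + (q ^ 3 + 2 * q ^ 2 + sv)
      = (p + q + 1) * (p ^ 2 + p + (q ^ 2 + q)) - p * q * (p + q)"
    using rec[of 1] wu(2-4) wv(2-4) unfolding s t by (simp add: eval_nat_numeral)
  then have s_sum: "su + sv = 2 * p * q + p + q"
    by algebra
  have "p ^ 4 + 3 * p ^ 3 + p ^ 2 - p + (2 * p + 1) * su + tu
      + (q ^ 4 + 3 * q ^ 3 + q ^ 2 - q + (2 * q + 1) * sv + tv)
      = (p + q + 1) * (p ^ 3 + 2 * p ^ 2 + su + (q ^ 3 + 2 * q ^ 2 + sv))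
        - p * q * (p ^ 2 + p + (q ^ 2 + q))"
    using rec[of 2] wu(3-5) wv(3-5) unfolding s t by (simp add: eval_nat_numeral)
  \<comment> \<open>After moving everything to one side, \<open>su\<close> and \<open>sv\<close>
    have coefficients \<open>p - q\<close> and \<open>q - p\<close>. Subtracting
    \<open>p + q + 2\<close> times \<open>s_sum\<close> turns them into \<open>- 2 * (q + 1)\<close>
    and \<open>- 2 * (p + 1)\<close>, the cross terms of squares centred at \<open>q + 1\<close> and
    \<open>p + 1\<close>.\<close>
  then have sq: "(tu - 2 * (q + 1) * su + p * (q + 1) ^ 2) + (tv - 2 * (p + 1) * sv + q * (p + 1) ^ 2)
      = - 2 * p * q"
    using s_sum by algebra
  \<comment> \<open>The sum has \<open>d x\<close> terms, so the constant \<open>c ^ 2\<close> is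
    counted \<open>d x\<close> times.\<close>
  have sum_sq: "(\<Sum>w\<in>nbrs E V x. (d w - c) ^ 2) =
      (\<Sum>w\<in>nbrs E V x. d w ^ 2) - 2 * c * (\<Sum>w\<in>nbrs E V x. d w) + d x * c ^ 2"
    if "x \<in> V" for x c
    using card_nbrs[OF assms(1) that]
    by (simp add: power2_diff sum.distrib sum_subtractf sum_distrib_left d_def mult_ac)
  have "(\<Sum>w\<in>nbrs E V u. (d w - (q + 1)) ^ 2) + (\<Sum>w\<in>nbrs E V v. (d w - (p + 1)) ^ 2) = - 2 * p * q"
    using sq unfolding sum_sq[OF assms(2)] sum_sq[OF assms(3)]
      su_def[symmetric] sv_def[symmetric] tu_def[symmetric] tv_def[symmetric]
      p_def[symmetric] q_def[symmetric] .
  \<comment> \<open>All quantities are degrees, so the complex identity descends to the reals, where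
    squares are nonnegative.\<close>
  then have "complex_of_real
      ((\<Sum>w\<in>nbrs E V u. (real (degree_of E w) - (real (degree_of E v) + 1)) ^ 2)
       + (\<Sum>w\<in>nbrs E V v. (real (degree_of E w) - (real (degree_of E u) + 1)) ^ 2))
      = complex_of_real (- 2 * real (degree_of E u) * real (degree_of E v))"
    by (simp add: d_def p_def q_def)
  then have "(\<Sum>w\<in>nbrs E V u. (real (degree_of E w) - (real (degree_of E v) + 1)) ^ 2)
       + (\<Sum>w\<in>nbrs E V v. (real (degree_of E w) - (real (degree_of E u) + 1)) ^ 2)
      = - 2 * real (degree_of E u) * real (degree_of E v)"
    by (simp only: of_real_eq_iff)
  moreover have "real (degree_of E u) * real (degree_of E v) > 0"
    using assms(6,7) by simp
  moreover have "(\<Sum>w\<in>nbrs E V x. (real (degree_of E w) - c) ^ 2) \<ge> 0" for x c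
    by (intro sum_nonneg) simp
  then have "(\<Sum>w\<in>nbrs E V u. (real (degree_of E w) - (real (degree_of E v) + 1)) ^ 2)
       + (\<Sum>w\<in>nbrs E V v. (real (degree_of E w) - (real (degree_of E u) + 1)) ^ 2) \<ge> 0"
    by (intro add_nonneg_nonneg)
  ultimately show False
    by simp
qed

theorem theorem3p8:
  fixes V :: "'a set" and E :: "'a set set"
  assumes "simple_graph V E"
    and "connected_graph V E"
    and "cyclomatic V E \<ge> 1"
    and "real (girth E) / real_of_int (cyclomatic V E) > 7 / 6"
  shows "\<forall>u\<in>V. \<forall>v\<in>V. u \<noteq> v \<and> {u, v} \<notin> E \<longrightarrow> \<not> LMRIV_two_places V E {u, v}"
  \<comment> \<open>Each end of the new edge is the second vertex that forces the degree of the
    other end to be positive.\<close>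
  using not_LMRIV_two_places[OF assms(1)] connected_graph_degree_pos[OF assms(1,2)]
  by (metis (no_types))

end
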